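(* Let $X$ and $Y$ be locally compact Hausdorff spaces. Let $\Phi\colon S(C_0(X))^+\to S(C_0(Y))^+$ be a surjective isometry, i.e. a surjective map with $\|\Phi(f)-\Phi(g)\|_\infty=\|f-g\|_\infty$ for all $f,g\in S(C_0(X))^+$. Then there exists a homeomorphism $\sigma\colon Y\to X$ such that $\Phi(f)=f\circ\sigma$ for all $f\in S(C_0(X))^+$.
   Context: For a locally compact Hausdorff space $K$, $C_0(K)$ denotes the real Banach space of all continuous real-valued functions on $K$ that vanish at infinity, equipped with the supremum norm $\|\cdot\|_\infty$. The positive unit sphere of $C_0(K)$ is $S(C_0(K))^+=\{f\in C_0(K):\|f\|_\infty=1,\ f\ge 0\}$, where $f \geq 0$ is meant pointwise. *)

theory Defs
  imports "HOL-Analysis.Analysis"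
begin

text \<open>A real function on a space is represented by an extensional function on its carrier
  (value \<^term>\<open>undefined\<close> off \<^term>\<open>topspace X\<close>), so that equality in \<open>C0 X\<close> is equality on the
  space.\<close>

definition C0 :: "'a topology \<Rightarrow> ('a \<Rightarrow> real) set" where
  "C0 X = {f \<in> extensional (topspace X). continuous_map X euclideanreal f \<and>
             (\<forall>e>0. compactin X {x \<in> topspace X. e \<le> \<bar>f x\<bar>})}"

text \<open>The \<open>insert 0\<close> makes the norm 0 on the empty space, and changes nothing otherwise.\<close>

definition sup_norm :: "'a topology \<Rightarrow> ('a \<Rightarrow> real) \<Rightarrow> real" where
  "sup_norm X f = Sup (insert 0 ((\<lambda>x. \<bar>f x\<bar>) ` topspace X))"

definition pos_unit_sphere :: "'a topology \<Rightarrow> ('a \<Rightarrow> real) set" where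
  "pos_unit_sphere X = {f \<in> C0 X. sup_norm X f = 1 \<and> (\<forall>x\<in>topspace X. 0 \<le> f x)}"

end

theory Submission
  imports Defs
begin

text \<open>
  Let \<open>\<Phi>\<close> be a surjective isometry between the positive unit spheres of \<open>C0 X\<close> and \<open>C0 Y\<close>. The
  points of \<open>X\<close> must be recovered from the metric alone. Distances in the sphere are at most 1,
  and the functions at the extreme distance 1 from \<open>h\<close> see the peak set \<open>{h = 1}\<close>: if every
  function at distance 1 from \<open>h\<close> is also at distance 1 from \<open>f\<close>, then \<open>{h = 1} \<subseteq> {f = 1}\<close>
  (\<open>peak_set_mono_if_far\<close>). The hypothesis of this implication is metric, so \<open>\<Phi>\<close> preserves it, and
  by the triangle inequality it holds when \<open>h\<close> is the mean of \<open>f\<close> and another member of the sphere.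

  Fix \<open>x\<close> and consider the functions with value 1 at \<open>x\<close>. They are closed under means, so
  the peak sets of their images form a downward directed family of nonempty compact sets, and
  compactness gives a point \<open>y\<close> where all these images have value 1 (\<open>common_peak\<close>). The value of
  \<open>g\<close> at \<open>x\<close> is \<open>1 - d\<close>, with \<open>d\<close> the distance from \<open>g\<close> to the set of functions with value 1 at
  \<open>x\<close> (\<open>near_peak_function\<close>); hence \<open>g x \<le> \<Phi> g y\<close> for all \<open>g\<close> (\<open>isometry_dominating_point\<close>).

  The same holds for the inverse of \<open>\<Phi>\<close>. The two point maps obtained in this way are mutually
  inverse because functions in the sphere can be concentrated near any given point, the two
  inequalities combine to \<open>\<Phi> f = f \<circ> \<sigma>\<close>, and continuity follows because the sphere determines
  the topology.
\<close>

section \<open>The positive unit sphere\<close>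

text \<open>The supremum in the norm is an unspecified number for an unbounded function, so boundedness
  must be extracted from vanishing at infinity. This comes together with attainment: on the
  compact set \<open>{f \<ge> 1/2}\<close> the function has a maximum, which is then the norm.\<close>

lemma pos_unit_sphere_le_1_and_attained:
  assumes "f \<in> pos_unit_sphere X"
  shows "(\<forall>x\<in>topspace X. f x \<le> 1) \<and> (\<exists>x\<in>topspace X. f x = 1)"
proof -
  have cf: "continuous_map X euclideanreal f"
    and K_all: "\<forall>e>0. compactin X {x \<in> topspace X. e \<le> \<bar>f x\<bar>}"
    and sup: "Sup (insert 0 ((\<lambda>x. \<bar>f x\<bar>) ` topspace X)) = 1"
    and nn: "\<And>x. x \<in> topspace X \<Longrightarrow> 0 \<le> f x"
    using assms by (auto simp: pos_unit_sphere_def C0_def sup_norm_def)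
  have K: "compactin X {x \<in> topspace X. 1/2 \<le> \<bar>f x\<bar>}"
    using K_all[rule_format, of "1/2"] by simp
  have "\<exists>t\<in>insert 0 ((\<lambda>x. \<bar>f x\<bar>) ` topspace X). 1/2 < t"
    using less_cSupD[of "insert 0 ((\<lambda>x. \<bar>f x\<bar>) ` topspace X)" "1/2"] sup by auto
  then obtain z where z: "z \<in> topspace X" "1/2 < \<bar>f z\<bar>" by auto
  have "compact (f ` {x \<in> topspace X. 1/2 \<le> \<bar>f x\<bar>})"
    using image_compactin[OF K cf] by simp
  moreover have "f ` {x \<in> topspace X. 1/2 \<le> \<bar>f x\<bar>} \<noteq> {}"
    using z by (auto intro!: exI[of _ z])
  ultimately obtain m where m: "m \<in> topspace X" "1/2 \<le> \<bar>f m\<bar>"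
    and max: "\<And>x. x \<in> topspace X \<Longrightarrow> 1/2 \<le> \<bar>f x\<bar> \<Longrightarrow> f x \<le> f m"
    using compact_attains_sup[of "f ` {x \<in> topspace X. 1/2 \<le> \<bar>f x\<bar>}"] by fastforce
  have le: "\<bar>f x\<bar> \<le> f m" if "x \<in> topspace X" for x
    using max[OF that] nn[OF that] nn[OF m(1)] m(2) by linarith
  have "Sup (insert 0 ((\<lambda>x. \<bar>f x\<bar>) ` topspace X)) = f m"
    using le m nn[OF m(1)] by (intro cSup_eq_maximum) (auto intro!: image_eqI[of _ _ m])
  with sup have "f m = 1" by simp
  with le m show ?thesis by fastforce
qed

lemma pos_unit_sphereD:
  assumes "f \<in> pos_unit_sphere X"
  shows "f \<in> extensional (topspace X)" "continuous_map X euclideanreal f"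
    and "\<And>e. 0 < e \<Longrightarrow> compactin X {x \<in> topspace X. e \<le> f x}"
    and "\<And>x. x \<in> topspace X \<Longrightarrow> 0 \<le> f x" "\<And>x. x \<in> topspace X \<Longrightarrow> f x \<le> 1"
proof -
  show nn: "\<And>x. x \<in> topspace X \<Longrightarrow> 0 \<le> f x"
    using assms by (auto simp: pos_unit_sphere_def)
  have "{x \<in> topspace X. e \<le> f x} = {x \<in> topspace X. e \<le> \<bar>f x\<bar>}" for e
    using nn by auto
  then show "compactin X {x \<in> topspace X. e \<le> f x}" if "0 < e" for e
    using assms that by (simp add: pos_unit_sphere_def C0_def)
qed (use assms pos_unit_sphere_le_1_and_attained[OF assms]
      in \<open>auto simp: pos_unit_sphere_def C0_def\<close>)

lemma pos_unit_sphereI: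
  assumes "f \<in> extensional (topspace X)" "continuous_map X euclideanreal f"
    and K: "\<And>e. 0 < e \<Longrightarrow> compactin X {x \<in> topspace X. e \<le> f x}"
    and nn: "\<And>x. x \<in> topspace X \<Longrightarrow> 0 \<le> f x" and le: "\<And>x. x \<in> topspace X \<Longrightarrow> f x \<le> 1"
    and a: "a \<in> topspace X" "f a = 1"
  shows "f \<in> pos_unit_sphere X"
proof -
  have "{x \<in> topspace X. e \<le> \<bar>f x\<bar>} = {x \<in> topspace X. e \<le> f x}" for e
    using nn by auto
  moreover have "sup_norm X f = 1"
    unfolding sup_norm_def using a nn le
    by (intro cSup_eq_maximum) (auto intro!: image_eqI[of _ _ a])
  ultimately show ?thesis
    using assms by (auto simp: pos_unit_sphere_def C0_def)
qed

text \<open>Being at most a sum of two members of the sphere forces a function to vanish at infinity.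
  This covers means, maxima, and products of a member with a function bounded by 1.\<close>

lemma pos_unit_sphere_dominated:
  assumes f: "f \<in> pos_unit_sphere X" and g: "g \<in> pos_unit_sphere X"
    and ck: "continuous_map X euclideanreal k"
    and nn: "\<And>x. x \<in> topspace X \<Longrightarrow> 0 \<le> k x" and le: "\<And>x. x \<in> topspace X \<Longrightarrow> k x \<le> 1"
    and a: "a \<in> topspace X" "k a = 1"
    and dom: "\<And>x. x \<in> topspace X \<Longrightarrow> k x \<le> f x + g x"
  shows "restrict k (topspace X) \<in> pos_unit_sphere X"
proof (rule pos_unit_sphereI)
  show "continuous_map X euclideanreal (restrict k (topspace X))"
    by (rule continuous_map_eq[OF ck]) auto
  show "compactin X {x \<in> topspace X. e \<le> restrict k (topspace X) x}" if "0 < e" for e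
  proof (rule closed_compactin)
    show "compactin X ({x \<in> topspace X. e/2 \<le> f x} \<union> {x \<in> topspace X. e/2 \<le> g x})"
      using that by (intro compactin_Un pos_unit_sphereD(3)[OF f] pos_unit_sphereD(3)[OF g]) auto
    show "{x \<in> topspace X. e \<le> restrict k (topspace X) x}
            \<subseteq> {x \<in> topspace X. e/2 \<le> f x} \<union> {x \<in> topspace X. e/2 \<le> g x}"
      using dom by fastforce
    have "{x \<in> topspace X. e \<le> restrict k (topspace X) x} = {x \<in> topspace X. k x \<in> {e..}}"
      by auto
    then show "closedin X {x \<in> topspace X. e \<le> restrict k (topspace X) x}"
      using closedin_continuous_map_preimage[OF ck, of "{e..}"] by simp
  qed
qed (use nn le a in auto)

text \<open>Local compactness makes the space completely regular, and confining the resulting Urysohn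
  function to a compact neighbourhood of \<open>x\<close> makes it vanish at infinity.\<close>

lemma bump_function:
  assumes "locally_compact_space X" "Hausdorff_space X" "openin X U" "x \<in> U"
  obtains u where "u \<in> pos_unit_sphere X" "u x = 1" "\<And>z. z \<in> topspace X - U \<Longrightarrow> u z = 0"
proof -
  have x: "x \<in> topspace X"
    using assms openin_subset by blast
  obtain V K where V: "openin X V" "compactin X K" "x \<in> V" "V \<subseteq> K"
    using assms(1) x unfolding locally_compact_space_def by blast
  have "completely_regular_space X"
    using assms locally_compact_regular_imp_completely_regular_space by blast
  moreover have "closedin X (topspace X - U \<inter> V)" "x \<in> topspace X - (topspace X - U \<inter> V)"
    using assms V x by auto
  ultimately obtain w where w: "continuous_map X (top_of_set {0..1}) w" "w x = (0::real)"
      "w ` (topspace X - U \<inter> V) \<subseteq> {1}"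
    unfolding completely_regular_space_def by meson
  have cw: "continuous_map X euclideanreal w" and w01: "\<And>z. z \<in> topspace X \<Longrightarrow> w z \<in> {0..1}"
    using w(1) by (auto simp: continuous_map_in_subtopology)
  define u where "u = restrict (\<lambda>z. 1 - w z) (topspace X)"
  have "continuous_map X euclideanreal (\<lambda>z. 1 - w z)"
    by (intro continuous_intros cw) auto
  then have cu: "continuous_map X euclideanreal u"
    by (rule continuous_map_eq) (auto simp: u_def)
  have u0: "u z = 0" if "z \<in> topspace X" "z \<notin> U \<inter> V" for z
    using w(3) that by (auto simp: u_def)
  have "u \<in> pos_unit_sphere X"
  proof (rule pos_unit_sphereI[OF _ cu _ _ _ x])
    show "compactin X {z \<in> topspace X. e \<le> u z}" if "0 < e" for e
    proof (rule closed_compactin[OF V(2)])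
      show "{z \<in> topspace X. e \<le> u z} \<subseteq> K"
        using u0 V(4) that by fastforce
      show "closedin X {z \<in> topspace X. e \<le> u z}"
        using closedin_continuous_map_preimage[OF cu, of "{e..}"] by simp
    qed
  qed (use w01 w(2) x in \<open>auto simp: u_def\<close>)
  moreover have "u x = 1"
    using w(2) x by (simp add: u_def)
  ultimately show thesis
    using that[of u] u0 by blast
qed

section \<open>Distances in the sphere\<close>

abbreviation sup_dist :: "'a topology \<Rightarrow> ('a \<Rightarrow> real) \<Rightarrow> ('a \<Rightarrow> real) \<Rightarrow> real" where
  "sup_dist X f g \<equiv> sup_norm X (\<lambda>x. f x - g x)"

lemma sup_dist_ge:
  assumes "f \<in> pos_unit_sphere X" "g \<in> pos_unit_sphere X" "x \<in> topspace X"
  shows "\<bar>f x - g x\<bar> \<le> sup_dist X f g"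
proof -
  have "\<bar>f z - g z\<bar> \<le> 1" if "z \<in> topspace X" for z
    using pos_unit_sphereD(4,5)[OF assms(1) that] pos_unit_sphereD(4,5)[OF assms(2) that]
    by linarith
  then have "bdd_above (insert 0 ((\<lambda>x. \<bar>f x - g x\<bar>) ` topspace X))"
    by (auto intro!: bdd_aboveI[of _ 1])
  then show ?thesis
    unfolding sup_norm_def using assms(3) by (intro cSup_upper) auto
qed

lemma sup_dist_le:
  assumes "0 \<le> c" "\<And>x. x \<in> topspace X \<Longrightarrow> \<bar>f x - g x\<bar> \<le> c"
  shows "sup_dist X f g \<le> c"
  unfolding sup_norm_def using assms by (intro cSup_least) auto

lemma sup_dist_eq_0_imp_eq:
  assumes "f \<in> pos_unit_sphere X" "g \<in> pos_unit_sphere X" "sup_dist X f g = 0"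
  shows "f = g"
proof (rule extensionalityI[OF pos_unit_sphereD(1)[OF assms(1)] pos_unit_sphereD(1)[OF assms(2)]])
  show "f x = g x" if "x \<in> topspace X" for x
    using sup_dist_ge[OF assms(1,2) that] assms(3) by simp
qed

definition mean :: "'a topology \<Rightarrow> ('a \<Rightarrow> real) \<Rightarrow> ('a \<Rightarrow> real) \<Rightarrow> 'a \<Rightarrow> real" where
  "mean X f g = (\<lambda>x\<in>topspace X. (f x + g x) / 2)"

text \<open>A common peak is needed for the mean to have norm 1.\<close>

lemma mean_in_pos_unit_sphere:
  assumes f: "f \<in> pos_unit_sphere X" and g: "g \<in> pos_unit_sphere X"
    and x: "x \<in> topspace X" "f x = 1" "g x = 1"
  shows "mean X f g \<in> pos_unit_sphere X"
  unfolding mean_def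
proof (rule pos_unit_sphere_dominated[OF f g _ _ _ x(1)])
  have "continuous_map X euclideanreal (\<lambda>x. (f x + g x) * (1/2))"
    using pos_unit_sphereD(2)[OF f] pos_unit_sphereD(2)[OF g]
    by (intro continuous_map_real_mult_right continuous_map_add)
  then show "continuous_map X euclideanreal (\<lambda>x. (f x + g x) / 2)"
    by simp
next
  fix z assume z: "z \<in> topspace X"
  note bounds = pos_unit_sphereD(4,5)[OF f z] pos_unit_sphereD(4,5)[OF g z]
  show "0 \<le> (f z + g z) / 2" "(f z + g z) / 2 \<le> 1" "(f z + g z) / 2 \<le> f z + g z"
    using bounds by auto
qed (use x in auto)

text \<open>The distance to the mean is at most the mean of the distances, and no distance exceeds 1,
  so the distance 1 to the mean forces the distance 1 to both functions.\<close>

lemma far_from_mean: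
  assumes f: "f \<in> pos_unit_sphere X" and g: "g \<in> pos_unit_sphere X" and k: "k \<in> pos_unit_sphere X"
    and far: "1 \<le> sup_dist X (mean X f g) k"
  shows "1 \<le> sup_dist X f k \<and> 1 \<le> sup_dist X g k"
proof -
  obtain a where a: "a \<in> topspace X"
    using pos_unit_sphere_le_1_and_attained[OF f] by blast
  have "sup_dist X (mean X f g) k \<le> (sup_dist X p k + 1) / 2" if "p = f \<or> p = g" for p
  proof (rule sup_dist_le)
    have p: "p \<in> pos_unit_sphere X"
      using that f g by auto
    show "0 \<le> (sup_dist X p k + 1) / 2"
      using sup_dist_ge[OF p k a] by simp
    fix z assume z: "z \<in> topspace X"
    note bounds = pos_unit_sphereD(4,5)[OF f z] pos_unit_sphereD(4,5)[OF g z]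
      pos_unit_sphereD(4,5)[OF k z]
    have "\<bar>(f z - k z) + (g z - k z)\<bar> \<le> \<bar>p z - k z\<bar> + 1"
      using that bounds by auto
    moreover have "mean X f g z - k z = ((f z - k z) + (g z - k z)) / 2"
      using z by (simp add: mean_def field_simps)
    ultimately have "2 * \<bar>mean X f g z - k z\<bar> \<le> \<bar>p z - k z\<bar> + 1"
      by (metis abs_divide abs_numeral nonzero_mult_div_cancel_left times_divide_eq_right
          zero_neq_numeral)
    then show "\<bar>mean X f g z - k z\<bar> \<le> (sup_dist X p k + 1) / 2"
      using sup_dist_ge[OF p k z] by simp
  qed
  from this[of f] this[of g] far show ?thesis
    by auto
qed

definition peak_set :: "'a topology \<Rightarrow> ('a \<Rightarrow> real) \<Rightarrow> 'a set" where
  "peak_set X f = {x \<in> topspace X. f x = 1}"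

text \<open>If \<open>h x = 1\<close> but \<open>f x < 1\<close>, push \<open>f\<close> down to 0 at \<open>x\<close> without touching it
  where it is close to 1. The result is at distance 1 from \<open>h\<close>, but closer to \<open>f\<close>.\<close>

lemma peak_set_mono_if_far:
  assumes X: "locally_compact_space X" "Hausdorff_space X"
    and h: "h \<in> pos_unit_sphere X" and f: "f \<in> pos_unit_sphere X"
    and far: "\<And>k. k \<in> pos_unit_sphere X \<Longrightarrow> 1 \<le> sup_dist X h k \<Longrightarrow> 1 \<le> sup_dist X f k"
  shows "peak_set X h \<subseteq> peak_set X f"
proof (rule ccontr)
  assume "\<not> peak_set X h \<subseteq> peak_set X f"
  then obtain x where x: "x \<in> topspace X" "h x = 1" "f x \<noteq> 1"
    by (auto simp: peak_set_def)
  note f01 = pos_unit_sphereD(4,5)[OF f]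
  have "f x < 1"
    using f01(2)[OF x(1)] x(3) by simp
  \<comment> \<open>The gap between \<open>c\<close> and 1 keeps the modified function at distance strictly below 1 from \<open>f\<close>.\<close>
  then obtain c where c: "f x < c" "c < 1"
    using dense by blast
  have "0 \<le> c"
    using f01(1)[OF x(1)] c by simp
  have "openin X {z \<in> topspace X. f z < c}"
    using openin_continuous_map_preimage[OF pos_unit_sphereD(2)[OF f], of "{..<c}"] by simp
  then obtain v where v: "v \<in> pos_unit_sphere X" "v x = 1"
    and v0: "\<And>z. z \<in> topspace X - {z \<in> topspace X. f z < c} \<Longrightarrow> v z = 0"
    using bump_function[OF X, of "{z \<in> topspace X. f z < c}" x] x(1) c by blast
  note v01 = pos_unit_sphereD(4,5)[OF v(1)]
  define k where "k = (\<lambda>z\<in>topspace X. f z * (1 - v z))"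
  obtain a where a: "a \<in> topspace X" "f a = 1"
    using pos_unit_sphere_le_1_and_attained[OF f] by blast
  have kf: "0 \<le> f z * (1 - v z)" "f z * (1 - v z) \<le> f z" if "z \<in> topspace X" for z
    using f01[OF that] v01[OF that] by (auto intro: mult_left_le)
  have k: "k \<in> pos_unit_sphere X"
    unfolding k_def
  proof (rule pos_unit_sphere_dominated[OF f f _ _ _ a(1)])
    show "continuous_map X euclideanreal (\<lambda>z. f z * (1 - v z))"
      using pos_unit_sphereD(2)[OF f] pos_unit_sphereD(2)[OF v(1)]
      by (intro continuous_intros) auto
    show "f a * (1 - v a) = 1"
      using a v0[of a] c by simp
    show "f z * (1 - v z) \<le> 1" "f z * (1 - v z) \<le> f z + f z" if "z \<in> topspace X" for z
      using kf[OF that] f01[OF that] by auto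
  qed (use kf in auto)
  have "1 \<le> sup_dist X h k"
    using sup_dist_ge[OF h k x(1)] x v(2) by (simp add: k_def)
  moreover have "sup_dist X f k \<le> c"
  proof (rule sup_dist_le)
    fix z assume z: "z \<in> topspace X"
    have "f z - k z = f z * v z"
      using z by (simp add: k_def algebra_simps)
    moreover have "0 \<le> f z * v z" "f z * v z \<le> c"
    proof -
      show "f z * v z \<le> c"
      proof (cases "f z < c")
        case True
        with f01[OF z] v01[OF z] show ?thesis
          by (meson less_eq_real_def mult_left_le order_trans)
      next
        case False
        with v0[of z] z \<open>0 \<le> c\<close> show ?thesis by simp
      qed
    qed (use f01[OF z] v01[OF z] in simp)
    ultimately show "\<bar>f z - k z\<bar> \<le> c" by simp
  qed fact
  ultimately show False
    using far[OF k] c by simp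
qed

text \<open>Raise \<open>g\<close> to 1 at \<open>x\<close> by a bump confined to \<open>{g > g x - e}\<close>.\<close>

lemma near_peak_function:
  assumes X: "locally_compact_space X" "Hausdorff_space X"
    and g: "g \<in> pos_unit_sphere X" and x: "x \<in> topspace X" and e: "0 < e"
  obtains f where "f \<in> pos_unit_sphere X" "f x = 1" "sup_dist X f g \<le> 1 - g x + e"
proof -
  note g01 = pos_unit_sphereD(4,5)[OF g]
  have "openin X {z \<in> topspace X. g x - e < g z}"
    using openin_continuous_map_preimage[OF pos_unit_sphereD(2)[OF g], of "{g x - e<..}"] by simp
  then obtain u where u: "u \<in> pos_unit_sphere X" "u x = 1"
    and u0: "\<And>z. z \<in> topspace X - {z \<in> topspace X. g x - e < g z} \<Longrightarrow> u z = 0"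
    using bump_function[OF X, of "{z \<in> topspace X. g x - e < g z}" x] x e by auto
  note u01 = pos_unit_sphereD(4,5)[OF u(1)]
  define f where "f = (\<lambda>z\<in>topspace X. max (g z) (u z))"
  have "f \<in> pos_unit_sphere X"
    unfolding f_def
  proof (rule pos_unit_sphere_dominated[OF g u(1) _ _ _ x])
    show "continuous_map X euclideanreal (\<lambda>z. max (g z) (u z))"
      using pos_unit_sphereD(2)[OF g] pos_unit_sphereD(2)[OF u(1)]
      by (intro continuous_map_real_max)
    show "0 \<le> max (g z) (u z)" "max (g z) (u z) \<le> 1" "max (g z) (u z) \<le> g z + u z"
      if "z \<in> topspace X" for z
      using g01[OF that] u01[OF that] by auto
    show "max (g x) (u x) = 1"
      using u(2) g01(2)[OF x] by simp
  qed
  moreover have "f x = 1"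
    using u(2) g01(2)[OF x] x by (simp add: f_def)
  moreover have "sup_dist X f g \<le> 1 - g x + e"
  proof (rule sup_dist_le)
    show "0 \<le> 1 - g x + e"
      using g01(2)[OF x] e by simp
    show "\<bar>f z - g z\<bar> \<le> 1 - g x + e" if z: "z \<in> topspace X" for z
    proof (cases "g x - e < g z")
      case True
      then show ?thesis
        using g01[OF z] u01[OF z] z by (simp add: f_def max_def)
    next
      case False
      then show ?thesis
        using u0[of z] g01[OF z] g01(2)[OF x] z e by (simp add: f_def)
    qed
  qed
  ultimately show thesis ..
qed

section \<open>Points recovered from the metric\<close>

text \<open>A finite set of functions with value 1 at \<open>x\<close> is treated by iterating the mean; the finite
  intersection property then yields a point for all of them.\<close>

lemma common_peak:
  fixes X :: "'a topology" and Y :: "'b topology" and T :: "('a \<Rightarrow> real) \<Rightarrow> ('b \<Rightarrow> real)"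
  assumes X: "locally_compact_space X" "Hausdorff_space X"
    and Y: "locally_compact_space Y" "Hausdorff_space Y"
    and onto: "T ` pos_unit_sphere X = pos_unit_sphere Y"
    and iso: "\<And>f g. f \<in> pos_unit_sphere X \<Longrightarrow> g \<in> pos_unit_sphere X \<Longrightarrow>
                sup_dist Y (T f) (T g) = sup_dist X f g"
    and x: "x \<in> topspace X"
  shows "\<exists>y\<in>topspace Y. \<forall>f\<in>pos_unit_sphere X. f x = 1 \<longrightarrow> T f y = 1"
proof -
  define P where "P = {f \<in> pos_unit_sphere X. f x = 1}"
  have TS: "T f \<in> pos_unit_sphere Y" if "f \<in> P" for f
    using onto that by (auto simp: P_def)
  obtain f0 where f0: "f0 \<in> P"
    using bump_function[OF X openin_topspace x] by (auto simp: P_def)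
  have directed: "\<exists>h\<in>P. peak_set Y (T h) \<subseteq> peak_set Y (T f) \<inter> peak_set Y (T g)"
    if f: "f \<in> P" and g: "g \<in> P" for f g
  proof
    have S: "f \<in> pos_unit_sphere X" "g \<in> pos_unit_sphere X"
      using f g by (auto simp: P_def)
    show mP: "mean X f g \<in> P"
      using mean_in_pos_unit_sphere[OF S x] f g x by (simp add: P_def mean_def)
    then have mS: "mean X f g \<in> pos_unit_sphere X"
      by (simp add: P_def)
    have "1 \<le> sup_dist Y (T f) k \<and> 1 \<le> sup_dist Y (T g) k"
      if k: "k \<in> pos_unit_sphere Y" and far: "1 \<le> sup_dist Y (T (mean X f g)) k" for k
    proof -
      obtain q where "q \<in> pos_unit_sphere X" "k = T q"
        using k onto by blast
      then show ?thesis
        using far_from_mean[OF S, of q] far iso S mS by simp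
    qed
    then show "peak_set Y (T (mean X f g)) \<subseteq> peak_set Y (T f) \<inter> peak_set Y (T g)"
      using peak_set_mono_if_far[OF Y TS[OF mP]] TS[OF f] TS[OF g] by auto
  qed
  have finite_directed: "\<exists>h\<in>P. \<forall>f\<in>F. peak_set Y (T h) \<subseteq> peak_set Y (T f)"
    if "finite F" "F \<subseteq> P" for F
    using that
  proof (induction F)
    case empty
    then show ?case using f0 by blast
  next
    case (insert f F)
    then obtain h where h: "h \<in> P" "\<forall>f\<in>F. peak_set Y (T h) \<subseteq> peak_set Y (T f)"
      by auto
    obtain h' where "h' \<in> P" "peak_set Y (T h') \<subseteq> peak_set Y (T f) \<inter> peak_set Y (T h)"
      using directed[of f h] h(1) insert.prems by auto
    with h(2) show ?case
      by (intro bexI[of _ h']) auto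
  qed
  define K where "K = {y \<in> topspace Y. 1 \<le> T f0 y}"
  have peak_f0: "peak_set Y (T f0) \<subseteq> K"
    by (auto simp: peak_set_def K_def)
  have "K \<inter> \<Inter>((\<lambda>f. peak_set Y (T f)) ` P) \<noteq> {}"
  proof -
    have "compactin Y K"
      unfolding K_def by (rule pos_unit_sphereD(3)[OF TS[OF f0]]) simp
    moreover have "closedin Y (peak_set Y (T f))" if "f \<in> P" for f
      using closedin_continuous_map_preimage[OF pos_unit_sphereD(2)[OF TS[OF that]], of "{1}"]
      by (simp add: peak_set_def)
    moreover have "K \<inter> \<Inter>\<F> \<noteq> {}"
      if "finite \<F>" "\<F> \<subseteq> (\<lambda>f. peak_set Y (T f)) ` P" for \<F>
    proof -
      obtain F where F: "finite F" "F \<subseteq> P" "\<F> = (\<lambda>f. peak_set Y (T f)) ` F"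
        using finite_subset_image[OF \<open>finite \<F>\<close> \<open>\<F> \<subseteq> _\<close>] by blast
      \<comment> \<open>Including \<open>f0\<close> places the peak set of \<open>T h\<close> inside the compact set \<open>K\<close>.\<close>
      obtain h where h: "h \<in> P" "\<forall>f\<in>insert f0 F. peak_set Y (T h) \<subseteq> peak_set Y (T f)"
        using finite_directed[of "insert f0 F"] F f0 by auto
      have "peak_set Y (T h) \<noteq> {}"
        using pos_unit_sphere_le_1_and_attained[OF TS[OF h(1)]] by (auto simp: peak_set_def)
      with h(2) F(3) peak_f0 show ?thesis by blast
    qed
    ultimately show ?thesis
      unfolding compactin_fip by (metis (no_types, lifting) imageE)
  qed
  then show ?thesis
    by (auto simp: P_def K_def peak_set_def)
qed

text \<open>If \<open>f\<close> has value 1 at \<open>x\<close>, then \<open>T f\<close> has value 1 at the point \<open>y\<close> of \<open>common_peak\<close>, so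
  \<open>1 - T g y\<close> is at most the distance from \<open>f\<close> to \<open>g\<close>, which can be made almost \<open>1 - g x\<close>.\<close>

lemma isometry_dominating_point:
  fixes X :: "'a topology" and Y :: "'b topology" and T :: "('a \<Rightarrow> real) \<Rightarrow> ('b \<Rightarrow> real)"
  assumes X: "locally_compact_space X" "Hausdorff_space X"
    and Y: "locally_compact_space Y" "Hausdorff_space Y"
    and onto: "T ` pos_unit_sphere X = pos_unit_sphere Y"
    and iso: "\<And>f g. f \<in> pos_unit_sphere X \<Longrightarrow> g \<in> pos_unit_sphere X \<Longrightarrow>
                sup_dist Y (T f) (T g) = sup_dist X f g"
    and x: "x \<in> topspace X"
  shows "\<exists>y\<in>topspace Y. \<forall>g\<in>pos_unit_sphere X. g x \<le> T g y"
proof -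
  obtain y where y: "y \<in> topspace Y"
    and peak: "\<And>f. f \<in> pos_unit_sphere X \<Longrightarrow> f x = 1 \<Longrightarrow> T f y = 1"
    using common_peak[OF X Y onto iso x] by blast
  have "g x \<le> T g y" if g: "g \<in> pos_unit_sphere X" for g
  proof (rule field_le_epsilon)
    fix e :: real assume "0 < e"
    then obtain f where f: "f \<in> pos_unit_sphere X" "f x = 1" "sup_dist X f g \<le> 1 - g x + e"
      using near_peak_function[OF X g x] by blast
    have "\<bar>T f y - T g y\<bar> \<le> sup_dist X f g"
      using sup_dist_ge[of "T f" Y "T g" y] f(1) g onto y iso by auto
    with f peak[OF f(1,2)] show "g x \<le> T g y + e"
      by simp
  qed
  with y show ?thesis by blast
qed

lemma points_eq_if_dominated:
  assumes X: "locally_compact_space X" "Hausdorff_space X"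
    and x: "x \<in> topspace X" "x' \<in> topspace X"
    and le: "\<And>f. f \<in> pos_unit_sphere X \<Longrightarrow> f x \<le> f x'"
  shows "x' = x"
proof (rule ccontr)
  assume "x' \<noteq> x"
  have "openin X (topspace X - {x'})"
    using X(2) by (simp add: open_in_Hausdorff_delete)
  then obtain u where "u \<in> pos_unit_sphere X" "u x = 1"
    and "\<And>z. z \<in> topspace X - (topspace X - {x'}) \<Longrightarrow> u z = 0"
    using bump_function[OF X, of "topspace X - {x'}" x] x \<open>x' \<noteq> x\<close> by blast
  with le[of u] x show False by simp
qed

text \<open>The positivity sets of members of the sphere form a base of the topology.\<close>

lemma continuous_map_if_pos_unit_sphere:
  assumes X: "locally_compact_space X" "Hausdorff_space X"
    and into: "\<And>y. y \<in> topspace Y \<Longrightarrow> \<rho> y \<in> topspace X"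
    and cont: "\<And>f. f \<in> pos_unit_sphere X \<Longrightarrow> continuous_map Y euclideanreal (\<lambda>y. f (\<rho> y))"
  shows "continuous_map Y X \<rho>"
  unfolding continuous_map
proof (intro conjI allI impI)
  fix U assume U: "openin X U"
  show "openin Y {y \<in> topspace Y. \<rho> y \<in> U}"
  proof (subst openin_subopen, intro ballI)
    fix y assume "y \<in> {y \<in> topspace Y. \<rho> y \<in> U}"
    then have y: "y \<in> topspace Y" "\<rho> y \<in> U" by auto
    obtain u where u: "u \<in> pos_unit_sphere X" "u (\<rho> y) = 1"
      and u0: "\<And>z. z \<in> topspace X - U \<Longrightarrow> u z = 0"
      using bump_function[OF X U y(2)] by blast
    let ?V = "{y \<in> topspace Y. u (\<rho> y) \<in> {0<..}}"
    have "openin Y ?V"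
      using openin_continuous_map_preimage[OF cont[OF u(1)], of "{0<..}"] by simp
    moreover have "?V \<subseteq> {y \<in> topspace Y. \<rho> y \<in> U}"
      using u0 into by fastforce
    ultimately show "\<exists>V. openin Y V \<and> y \<in> V \<and> V \<subseteq> {y \<in> topspace Y. \<rho> y \<in> U}"
      using y u(2) by (intro exI[of _ ?V]) auto
  qed
qed (use into in auto)

section \<open>The representation theorem\<close>

theorem theorem3p1:
  fixes X :: "'a topology" and Y :: "'b topology"
    and \<Phi> :: "('a \<Rightarrow> real) \<Rightarrow> ('b \<Rightarrow> real)"
  assumes "locally_compact_space X" and "Hausdorff_space X"
    and "locally_compact_space Y" and "Hausdorff_space Y"
    and "\<Phi> ` pos_unit_sphere X = pos_unit_sphere Y"
    and "\<And>f g. f \<in> pos_unit_sphere X \<Longrightarrow> g \<in> pos_unit_sphere X \<Longrightarrow>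
           sup_norm Y (\<lambda>y. \<Phi> f y - \<Phi> g y) = sup_norm X (\<lambda>x. f x - g x)"
  shows "\<exists>\<sigma>. homeomorphic_map Y X \<sigma> \<and>
           (\<forall>f\<in>pos_unit_sphere X. \<Phi> f = compose (topspace Y) f \<sigma>)"
proof -
  note X = assms(1,2) and Y = assms(3,4) and onto = assms(5) and iso = assms(6)
  define \<Psi> where "\<Psi> = inv_into (pos_unit_sphere X) \<Phi>"
  have inj: "inj_on \<Phi> (pos_unit_sphere X)"
  proof (rule inj_onI)
    fix f g assume fg: "f \<in> pos_unit_sphere X" "g \<in> pos_unit_sphere X" and eq: "\<Phi> f = \<Phi> g"
    have "sup_dist Y (\<Phi> f) (\<Phi> g) = 0"
      using eq by (simp add: sup_norm_def image_constant_conv)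
    then have "sup_dist X f g = 0"
      using iso[OF fg] by simp
    then show "f = g"
      using sup_dist_eq_0_imp_eq[OF fg] by simp
  qed
  have \<Psi>: "\<Psi> k \<in> pos_unit_sphere X" "\<Phi> (\<Psi> k) = k" if "k \<in> pos_unit_sphere Y" for k
    using that onto by (auto simp: \<Psi>_def inv_into_into f_inv_into_f)
  have \<Psi>\<Phi>: "\<Psi> (\<Phi> f) = f" if "f \<in> pos_unit_sphere X" for f
    using inj that by (simp add: \<Psi>_def)
  have \<Phi>S: "\<Phi> f \<in> pos_unit_sphere Y" if "f \<in> pos_unit_sphere X" for f
    using onto that by blast
  have onto': "\<Psi> ` pos_unit_sphere Y = pos_unit_sphere X"
    using \<Psi>(1) \<Psi>\<Phi> \<Phi>S by (force simp: image_iff)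
  have iso': "sup_dist X (\<Psi> k) (\<Psi> l) = sup_dist Y k l"
    if "k \<in> pos_unit_sphere Y" "l \<in> pos_unit_sphere Y" for k l
    using iso[of "\<Psi> k" "\<Psi> l"] \<Psi> that by simp
  obtain \<tau> where \<tau>: "\<And>x. x \<in> topspace X \<Longrightarrow> \<tau> x \<in> topspace Y"
    and \<tau>_le: "\<And>x f. x \<in> topspace X \<Longrightarrow> f \<in> pos_unit_sphere X \<Longrightarrow> f x \<le> \<Phi> f (\<tau> x)"
    using isometry_dominating_point[OF X Y onto iso] by metis
  obtain \<sigma> where \<sigma>: "\<And>y. y \<in> topspace Y \<Longrightarrow> \<sigma> y \<in> topspace X"
    and \<sigma>_le: "\<And>y k. y \<in> topspace Y \<Longrightarrow> k \<in> pos_unit_sphere Y \<Longrightarrow> k y \<le> \<Psi> k (\<sigma> y)"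
    using isometry_dominating_point[OF Y X onto' iso'] by metis
  have \<sigma>\<tau>: "\<sigma> (\<tau> x) = x" if x: "x \<in> topspace X" for x
  proof (rule points_eq_if_dominated[OF X x])
    show "f x \<le> f (\<sigma> (\<tau> x))" if f: "f \<in> pos_unit_sphere X" for f
      using \<tau>_le[OF x f] \<sigma>_le[OF \<tau>[OF x] \<Phi>S[OF f]] \<Psi>\<Phi>[OF f] by simp
  qed (use \<tau> \<sigma> x in auto)
  have \<tau>\<sigma>: "\<tau> (\<sigma> y) = y" if y: "y \<in> topspace Y" for y
  proof (rule points_eq_if_dominated[OF Y y])
    show "k y \<le> k (\<tau> (\<sigma> y))" if k: "k \<in> pos_unit_sphere Y" for k
      using \<sigma>_le[OF y k] \<tau>_le[OF \<sigma>[OF y] \<Psi>(1)[OF k]] \<Psi>(2)[OF k] by simp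
  qed (use \<tau> \<sigma> y in auto)
  have val: "\<Phi> f y = f (\<sigma> y)" if f: "f \<in> pos_unit_sphere X" and y: "y \<in> topspace Y" for f y
    using \<tau>_le[OF \<sigma>[OF y] f] \<tau>\<sigma>[OF y] \<sigma>_le[OF y \<Phi>S[OF f]] \<Psi>\<Phi>[OF f] by simp
  have "continuous_map Y X \<sigma>"
  proof (rule continuous_map_if_pos_unit_sphere[OF X \<sigma>])
    show "continuous_map Y euclideanreal (\<lambda>y. f (\<sigma> y))" if f: "f \<in> pos_unit_sphere X" for f
      by (rule continuous_map_eq[OF pos_unit_sphereD(2)[OF \<Phi>S[OF f]]]) (use val f in auto)
  qed
  moreover have "continuous_map X Y \<tau>"
  proof (rule continuous_map_if_pos_unit_sphere[OF Y \<tau>])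
    show "continuous_map X euclideanreal (\<lambda>x. k (\<tau> x))" if k: "k \<in> pos_unit_sphere Y" for k
      by (rule continuous_map_eq[OF pos_unit_sphereD(2)[OF \<Psi>(1)[OF k]]])
        (use val[OF \<Psi>(1)[OF k]] \<Psi>(2)[OF k] \<tau> \<sigma>\<tau> in auto)
  qed
  ultimately have "homeomorphic_maps Y X \<sigma> \<tau>"
    using \<sigma>\<tau> \<tau>\<sigma> by (simp add: homeomorphic_maps_def)
  then have "homeomorphic_map Y X \<sigma>"
    by (rule homeomorphic_maps_imp_map)
  moreover have "\<Phi> f = compose (topspace Y) f \<sigma>" if f: "f \<in> pos_unit_sphere X" for f
  proof (rule extensionalityI[OF pos_unit_sphereD(1)[OF \<Phi>S[OF f]] compose_extensional])
    show "\<Phi> f y = compose (topspace Y) f \<sigma> y" if "y \<in> topspace Y" for y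
      using val[OF f that] that by (simp add: compose_eq)
  qed
  ultimately show ?thesis by blast
qed

end
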